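(* Let $p,q,r\in\mathbb{R}$. The polynomial $x^3+px^2+qx+r$ is a Ramanujan cubic polynomial if and only if there exist $h,s\in\mathbb{R}$ with $s\neq 0$ such that $$r=s^3,\qquad q=-(h+3)s^2,\qquad p=hs.$$
   Context: A Ramanujan cubic polynomial (RCP) is a cubic polynomial $x^3+px^2+qx+r$ with $p,q,r\in\mathbb{R}$, $r\neq 0$, all of whose zeros are real and whose coefficients satisfy $p\,r^{1/3}+3\,r^{2/3}+q=0$. Here $r^{1/3}$ denotes the real cube root and $r^{2/3}=(r^{1/3})^2$. *)

theory Defs
  imports Complex_Main "HOL-Computational_Algebra.Polynomial"
begin

(* Coefficients are listed in ascending order: [:r, q, p, 1:] is x^3 + p x^2 + q x + r.
   The zeros meant are the complex ones. root 3 is the real cube root, odd also on negative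
   arguments (unlike powr). *)
definition ramanujan_cubic :: "real poly \<Rightarrow> bool" where
  "ramanujan_cubic f \<longleftrightarrow>
     (\<exists>p q r. f = [:r, q, p, 1:] \<and> r \<noteq> 0 \<and>
        (\<forall>z::complex. poly (map_poly of_real f) z = 0 \<longrightarrow> z \<in> \<real>) \<and>
        p * root 3 r + 3 * (root 3 r)^2 + q = 0)"

end

theory Submission
  imports Defs
begin

text \<open>
  Substituting \<open>x = s y\<close> reduces the cubic to \<open>F(y) = y\<^sup>3 + h y\<^sup>2 - (h + 3) y + 1\<close>, one of Shanks'
  simplest cubics: its zeros are permuted by \<open>a \<mapsto> 1/(1 - a)\<close>, of order three. As \<open>F 0 = 1\<close>
  and \<open>F 1 = -1\<close>, there is a real zero \<open>a\<close> in \<open>(0, 1)\<close>, and then the other two zeros,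
  \<open>1/(1 - a)\<close> and \<open>(a - 1)/a\<close>, are real as well.
\<close>

lemma simplest_cubic_zero_real:
  fixes h :: real and w :: complex
  assumes w: "w^3 + of_real h * w^2 - of_real (h + 3) * w + 1 = 0"
  shows "w \<in> \<real>"
proof -
  let ?F = "\<lambda>y::real. y^3 + h * y^2 - (h + 3) * y + 1"
  have "\<exists>a\<ge>0. a \<le> 1 \<and> ?F a = 0"
    by (rule IVT2') (auto intro!: continuous_intros)
  then obtain a where a: "a \<ge> 0" "a \<le> 1" "?F a = 0"
    by blast
  have "a \<noteq> 0" "a \<noteq> 1"
    using a(3) by auto
  define b :: complex where "b = of_real a"
  have b: "b \<noteq> 0" "1 - b \<noteq> 0"
    using \<open>a \<noteq> 0\<close> \<open>a \<noteq> 1\<close> by (auto simp: b_def)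
  have "complex_of_real (?F a) = 0"
    using a(3) by (simp only: of_real_0)
  then have Fb: "b^3 + of_real h * b^2 - of_real (h + 3) * b + 1 = 0"
    by (simp add: b_def)
  \<comment> \<open>The left side is the product of the three linear factors for the zeros
    \<open>b\<close>, \<open>1 / (1 - b)\<close>, \<open>(b - 1) / b\<close>, with denominators
    cleared, whence the leading coefficient \<open>b * (1 - b)\<close>. It agrees with that multiple
    of the cubic only modulo the relation for \<open>b\<close>; the last summand is the
    correction.\<close>
  have "(w - b) * ((1 - b) * w - 1) * (b * w - (b - 1)) =
      b * (1 - b) * (w^3 + of_real h * w^2 - of_real (h + 3) * w + 1)
      + (b^3 + of_real h * b^2 - of_real (h + 3) * b + 1) * (w^2 - w)"
    by (simp add: algebra_simps power2_eq_square power3_eq_cube)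
  then have "(w - b) * ((1 - b) * w - 1) * (b * w - (b - 1)) = 0"
    by (simp only: w Fb mult_zero_left mult_zero_right add_0)
  then consider "w = b" | "(1 - b) * w = 1" | "b * w = b - 1"
    by auto
  then have "w = b \<or> w = 1 / (1 - b) \<or> w = (b - 1) / b"
    using b by cases (auto simp: field_simps)
  moreover have "b \<in> \<real>"
    by (simp add: b_def)
  ultimately show ?thesis
    by auto
qed

theorem theorem3:
  fixes p q r :: real
  shows "ramanujan_cubic [:r, q, p, 1:] \<longleftrightarrow>
    (\<exists>h s::real. s \<noteq> 0 \<and> r = s^3 \<and> q = - (h + 3) * s^2 \<and> p = h * s)"
proof
  assume "ramanujan_cubic [:r, q, p, 1:]"
  then have "r \<noteq> 0" and rel: "p * root 3 r + 3 * (root 3 r)^2 + q = 0"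
    by (auto simp: ramanujan_cubic_def)
  define s where "s = root 3 r"
  have "s \<noteq> 0" and "r = s^3"
    using \<open>r \<noteq> 0\<close> by (simp_all add: s_def odd_real_root_pow)
  \<comment> \<open>The witness \<open>h = p / s\<close> is forced by \<open>p = h * s\<close>; the
    coefficient relation, read with \<open>s\<close> as the cube root of \<open>r\<close>, then
    yields \<open>q\<close>.\<close>
  moreover have "(p / s + 3) * s^2 = p * s + 3 * s^2" and "p = p / s * s"
    using \<open>s \<noteq> 0\<close> by (simp_all add: distrib_right power2_eq_square)
  moreover from this have "q = - (p / s + 3) * s^2"
    using rel unfolding s_def[symmetric] mult_minus_left by linarith
  ultimately show "\<exists>h s. s \<noteq> 0 \<and> r = s^3 \<and> q = - (h + 3) * s^2 \<and> p = h * s"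
    by blast
next
  assume "\<exists>h s. s \<noteq> 0 \<and> r = s^3 \<and> q = - (h + 3) * s^2 \<and> p = h * s"
  then obtain h s where s: "s \<noteq> 0" and r: "r = s^3"
    and q: "q = - (h + 3) * s^2" and p: "p = h * s"
    by blast
  \<comment> \<open>This holds for negative \<open>s\<close> too, since the real cube root is
    odd.\<close>
  have "root 3 r = s"
    by (simp add: r odd_real_root_power_cancel)
  then have "p * root 3 r + 3 * (root 3 r)^2 + q = 0"
    by (simp add: p q algebra_simps power2_eq_square)
  moreover have "z \<in> \<real>" if z: "poly (map_poly of_real [:r, q, p, 1:]) z = 0" for z :: complex
  proof -
    define w where "w = z / of_real s"
    have zw: "z = of_real s * w"
      using s by (simp add: w_def)
    \<comment> \<open>\<open>p\<close>, \<open>q\<close>, \<open>r\<close> carry the factors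
      \<open>s\<close>, \<open>s^2\<close>, \<open>s^3\<close>, so every term at
      \<open>z = s * w\<close> contains exactly \<open>s^3\<close>.\<close>
    have "of_real s ^ 3 * (w^3 + of_real h * w^2 - of_real (h + 3) * w + 1) =
        poly (map_poly of_real [:r, q, p, 1:]) z"
      by (simp add: map_poly_pCons zw p q r algebra_simps power2_eq_square power3_eq_cube)
    then have "w^3 + of_real h * w^2 - of_real (h + 3) * w + 1 = 0"
      using z s by simp
    then have "w \<in> \<real>"
      by (rule simplest_cubic_zero_real)
    then show ?thesis
      by (simp add: zw)
  qed
  ultimately show "ramanujan_cubic [:r, q, p, 1:]"
    using s r by (auto simp: ramanujan_cubic_def)
qed

end
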